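(* Let $G$ be a connected graph of order $n$ and size $m$ (number of edges), and let $\gamma_{\rm esp}=\gamma_{\rm esp}(G)$ be its end super domination number. Then $$m\ge 2(n-\gamma_{\rm esp})-1,$$ with equality if and only if $G$ is a tree and $G\in\mathcal{T}$ (that is, $G$ is a tree having a $2$-coloring with which it belongs to the family $\mathcal{T}$).
   Context: Graphs are finite, simple and undirected. For a graph $G=(V,E)$ and $S\subseteq V$, write $\overline{S}=V\setminus S$, and let $N(v)$ be the open neighbourhood of $v$. A set $S \subseteq V$ is an end super dominating set (ESD-set) of $G$ if for every $u\in\overline{S}$ there exists $v\in S$ with $N(v)\cap\overline{S}=\{u\}$, and moreover $\deg(u)\ge 2$ for every $u\in\overline{S}$. The end super domination number $\gamma_{\rm esp}(G)$ is the minimum cardinality of an ESD-set of $G$. A $2$-coloring of a tree $T$ is an assignment of one of the two colors amber and blue to each vertex of $T$ (no properness is required). The family $\mathcal{T}$ is the family of $2$-colored trees that can be obtained as the last term $T_k$ of a sequence $T_1,\ldots,T_k$, $k\ge 1$, of $2$-colored trees, where $T_1$ is the path $P_4$ with its two leaves colored blue and its two vertices of degree $2$ colored amber, and, if $k\ge 2$, for each $i\in\{1,\ldots,k-1\}$ the $2$-colored tree $T_{i+1}$ is obtained from $T_i$ by one of the following two operations. Operation $\mathcal{O}_1$: add a (vertex-disjoint) path $P_2$ to $T_i$, with one vertex of the added path colored amber and the other blue, and add an edge from the amber vertex of the added path to an amber vertex of $T_i$. Operation $\mathcal{O}_2$: add a (vertex-disjoint) path $P_4$ to $T_i$, with its two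 leaves colored blue and its two vertices of degree $2$ colored amber, and add an edge from a (blue) leaf of the added path to a blue vertex of $T_i$. *)

theory Defs
  imports Main
begin

(* A graph is given by a vertex set V and a set E of two-element edges, hence undirected
   and without loops or multiple edges. *)

definition simple_graph :: "'a set \<Rightarrow> 'a set set \<Rightarrow> bool" where
  "simple_graph V E \<longleftrightarrow> finite V \<and> (\<forall>e\<in>E. e \<subseteq> V \<and> card e = 2)"

definition adj :: "'a set set \<Rightarrow> 'a \<Rightarrow> 'a \<Rightarrow> bool" where
  "adj E u v \<longleftrightarrow> {u, v} \<in> E"

definition nbhd :: "'a set set \<Rightarrow> 'a \<Rightarrow> 'a set" where
  "nbhd E v = {u. adj E v u}"

definition degree :: "'a set set \<Rightarrow> 'a \<Rightarrow> nat" where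
  "degree E v = card (nbhd E v)"

definition connected_graph :: "'a set \<Rightarrow> 'a set set \<Rightarrow> bool" where
  "connected_graph V E \<longleftrightarrow>
     simple_graph V E \<and> V \<noteq> {} \<and> (\<forall>u\<in>V. \<forall>v\<in>V. (adj E)\<^sup>*\<^sup>* u v)"

definition is_cycle :: "'a set set \<Rightarrow> 'a list \<Rightarrow> bool" where
  "is_cycle E xs \<longleftrightarrow>
     length xs \<ge> 3 \<and> distinct xs \<and> successively (adj E) xs \<and> adj E (last xs) (hd xs)"

definition is_tree :: "'a set \<Rightarrow> 'a set set \<Rightarrow> bool" where
  "is_tree V E \<longleftrightarrow> connected_graph V E \<and> \<not> (\<exists>xs. is_cycle E xs)"

definition esd_set :: "'a set \<Rightarrow> 'a set set \<Rightarrow> 'a set \<Rightarrow> bool" where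
  "esd_set V E S \<longleftrightarrow>
     S \<subseteq> V \<and>
     (\<forall>u\<in>V - S. (\<exists>v\<in>S. nbhd E v \<inter> (V - S) = {u}) \<and> degree E u \<ge> 2)"

definition gamma_esp :: "'a set \<Rightarrow> 'a set set \<Rightarrow> nat" where
  "gamma_esp V E = Min (card ` {S. esd_set V E S})"

(* The minimum ranges over a finite nonempty set: V itself is always an ESD-set. *)
lemma gamma_esp_well_defined:
  assumes "finite V"
  shows "finite (card ` {S. esd_set V E S})" and "card ` {S. esd_set V E S} \<noteq> {}"
proof -
  have "{S. esd_set V E S} \<subseteq> Pow V"
    by (auto simp: esd_set_def)
  then show "finite (card ` {S. esd_set V E S})"
    using assms by (meson finite_Pow_iff finite_imageI finite_subset)
  have "esd_set V E V"
    by (simp add: esd_set_def)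
  then show "card ` {S. esd_set V E S} \<noteq> {}"
    by blast
qed

datatype color = Amber | Blue

(* family_T V E c: the tree (V, E) with the coloring c belongs to the family.
   Only the values of c on V matter.  The vertices of each rule are arbitrary, so the
   family is closed under isomorphism; as every T_i is a subgraph of the last tree T_k,
   building all of them over one vertex type is no restriction. *)
inductive family_T :: "'a set \<Rightarrow> 'a set set \<Rightarrow> ('a \<Rightarrow> color) \<Rightarrow> bool" where
  P4: "distinct [p, q, r, s] \<Longrightarrow>
       c p = Blue \<Longrightarrow> c q = Amber \<Longrightarrow> c r = Amber \<Longrightarrow> c s = Blue \<Longrightarrow>
       family_T {p, q, r, s} {{p, q}, {q, r}, {r, s}} c"
| O1: "family_T V E c \<Longrightarrow>
       distinct [x, y] \<Longrightarrow> {x, y} \<inter> V = {} \<Longrightarrow>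
       w \<in> V \<Longrightarrow> c w = Amber \<Longrightarrow>
       family_T (V \<union> {x, y}) (E \<union> {{x, y}, {x, w}}) (c(x := Amber, y := Blue))"
| O2: "family_T V E c \<Longrightarrow>
       distinct [p, q, r, s] \<Longrightarrow> {p, q, r, s} \<inter> V = {} \<Longrightarrow>
       w \<in> V \<Longrightarrow> c w = Blue \<Longrightarrow>
       family_T (V \<union> {p, q, r, s}) (E \<union> {{p, q}, {q, r}, {r, s}, {p, w}})
         (c(p := Blue, q := Amber, r := Amber, s := Blue))"

end

theory Submission
  imports Defs
begin

text \<open>
  Picking for every vertex \<open>u\<close> outside an ESD-set \<open>S\<close> a vertex of \<open>S\<close> whose only neighbour outside
  \<open>S\<close> is \<open>u\<close> gives an injection into \<open>S\<close>, so \<open>n \<ge> 2 (n - |S|)\<close>, and connectedness gives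
  \<open>m \<ge> n - 1\<close>. In case of equality \<open>m = n - 1\<close> and the injection is a bijection: the edges between
  \<open>S\<close> (blue) and its complement (amber) form a perfect matching, and every amber vertex has an amber
  neighbour. A largest vertex set that is closed under the matching and induces a member of the
  family is then everything: an edge leaving it joins two amber vertices and permits the first
  operation, or it joins two blue vertices and permits the second one. That no further edges are
  induced follows from counting, because a set \<open>W\<close> of vertices induces at most \<open>|W| - 1\<close> edges.
\<close>

section \<open>Edges induced by a vertex set of a connected graph\<close>

definition induced_edges :: "'a set set \<Rightarrow> 'a set \<Rightarrow> 'a set set" where
  "induced_edges E W = {e \<in> E. e \<subseteq> W}"

lemma simple_graph_edgeD:
  assumes "simple_graph V E" "{u, v} \<in> E"
  shows "u \<in> V" "v \<in> V" "u \<noteq> v"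
  using assms by (auto simp: simple_graph_def)

lemma simple_graph_finite_edges:
  assumes "simple_graph V E"
  shows "finite E"
  using assms by (meson Pow_iff finite_Pow_iff finite_subset simple_graph_def subsetI)

lemma connected_graph_leaving_edge:
  assumes "connected_graph V E" "W \<subseteq> V" "W \<noteq> {}" "W \<noteq> V"
  obtains w x where "w \<in> W" "x \<in> V - W" "{w, x} \<in> E"
proof -
  obtain a b where ab: "a \<in> W" "b \<in> V" "b \<notin> W"
    using assms(2-4) by blast
  have "(adj E)\<^sup>*\<^sup>* a b"
    using assms(1,2) ab by (auto simp: connected_graph_def)
  then have "b \<notin> W \<Longrightarrow> \<exists>w x. w \<in> W \<and> x \<notin> W \<and> adj E w x"
    by (induction rule: rtranclp_induct) (use ab(1) in auto)
  with ab(3) obtain w x where "w \<in> W" "x \<notin> W" "{w, x} \<in> E"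
    by (auto simp: adj_def)
  moreover have "x \<in> V"
    using assms(1) \<open>{w, x} \<in> E\<close> simple_graph_edgeD(2) by (metis connected_graph_def)
  ultimately show thesis
    using that by blast
qed

text \<open>Grow \<open>W\<close> to \<open>V\<close> one vertex at a time, always along an edge
  that leaves the current set. Each added vertex brings such an edge, which was not induced before,
  so the outside vertices account for distinct edges that \<open>W\<close> does not induce.\<close>

lemma card_induced_edges_le:
  assumes "connected_graph V E" "W \<subseteq> V" "W \<noteq> {}"
  shows "card (induced_edges E W) + card (V - W) \<le> card E"
  using assms(2,3)
proof (induction "card (V - W)" arbitrary: W)
  case 0
  have "finite E"
    using assms(1) simple_graph_finite_edges by (auto simp: connected_graph_def)
  then have "card (induced_edges E W) \<le> card E"
    by (intro card_mono) (auto simp: induced_edges_def)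
  with 0 show ?case by simp
next
  case (Suc k)
  have fin: "finite V" "finite E"
    using assms(1) simple_graph_finite_edges by (auto simp: connected_graph_def simple_graph_def)
  have "W \<noteq> V"
    using Suc.hyps(2) by auto
  then obtain w x where wx: "w \<in> W" "x \<in> V - W" "{w, x} \<in> E"
    using connected_graph_leaving_edge assms(1) Suc.prems by metis
  have "V - insert x W = (V - W) - {x}"
    by blast
  then have k: "k = card (V - insert x W)"
    using Suc.hyps(2) wx fin by simp
  have IH: "card (induced_edges E (insert x W)) + card (V - insert x W) \<le> card E"
    by (rule Suc.hyps(1)[OF k]) (use Suc.prems wx in auto)
  have "insert {w, x} (induced_edges E W) \<subseteq> induced_edges E (insert x W)"
    using wx by (auto simp: induced_edges_def)
  moreover have "finite (induced_edges E (insert x W))" "finite (induced_edges E W)"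
    using fin by (auto simp: induced_edges_def)
  ultimately have "card (insert {w, x} (induced_edges E W)) \<le> card (induced_edges E (insert x W))"
    by (intro card_mono) auto
  moreover have "{w, x} \<notin> induced_edges E W"
    using wx by (auto simp: induced_edges_def)
  ultimately have "Suc (card (induced_edges E W)) \<le> card (induced_edges E (insert x W))"
    using \<open>finite (induced_edges E W)\<close> by simp
  with IH k Suc.hyps(2) show ?case by simp
qed

lemma connected_graph_card_vertices_le:
  assumes "connected_graph V E"
  shows "card V \<le> card E + 1"
proof -
  obtain x where "x \<in> V"
    using assms by (auto simp: connected_graph_def)
  then have "card (V - {x}) \<le> card E"
    using card_induced_edges_le[OF assms, of "{x}"] by simp
  with \<open>x \<in> V\<close> show ?thesis
    using assms by (auto simp: connected_graph_def simple_graph_def)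
qed

text \<open>Acyclicity in counting form: it serves both to exclude cycles and to show that a set
  grown by one of the operations induces no unexpected edge.\<close>

lemma card_induced_edges_less:
  assumes "connected_graph V E" "card V = card E + 1" "W \<subseteq> V" "W \<noteq> {}"
  shows "card (induced_edges E W) < card W"
proof -
  have "finite V"
    using assms(1) by (auto simp: connected_graph_def simple_graph_def)
  then have "card (V - W) + card W = card V"
    using assms(3) by (metis card_Diff_subset card_mono finite_subset le_add_diff_inverse2)
  with card_induced_edges_le[OF assms(1,3,4)] assms(2) show ?thesis
    by linarith
qed

section \<open>Cycles, and recognizing a tree by its number of edges\<close>

lemma is_cycle_edge:
  assumes "is_cycle E xs" "i < length xs"
  shows "{xs ! i, xs ! (Suc i mod length xs)} \<in> E"
proof (cases "Suc i < length xs")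
  case True
  then show ?thesis
    using assms(1) by (auto simp: is_cycle_def successively_conv_nth adj_def)
next
  case False
  with assms(2) have i: "Suc i = length xs" by simp
  then have "i = length xs - 1" "xs \<noteq> []" by auto
  moreover have "{last xs, hd xs} \<in> E"
    using assms(1) by (simp add: is_cycle_def adj_def)
  ultimately show ?thesis
    using i by (simp add: last_conv_nth hd_conv_nth)
qed

lemma card_induced_edges_cycle:
  assumes "is_cycle E xs" "finite E"
  shows "length xs \<le> card (induced_edges E (set xs))"
proof -
  let ?n = "length xs"
  let ?e = "\<lambda>i. {xs ! i, xs ! (Suc i mod ?n)}"
  from assms have n: "?n \<ge> 3" and d: "distinct xs"
    by (auto simp: is_cycle_def)
  have sub: "?e ` {..<?n} \<subseteq> induced_edges E (set xs)"
    using n is_cycle_edge[OF assms(1)]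
    by (auto simp: induced_edges_def intro!: nth_mem mod_less_divisor)
  have "inj_on ?e {..<?n}"
  proof
    fix i j assume ij: "i \<in> {..<?n}" "j \<in> {..<?n}" "?e i = ?e j"
    have m: "Suc i mod ?n < ?n" "Suc j mod ?n < ?n"
      using n by (auto intro!: mod_less_divisor)
    show "i = j"
    proof (rule ccontr)
      assume "i \<noteq> j"
      \<comment> \<open>Two equal edges at different positions would make \<open>i\<close> and
        \<open>j\<close> cyclic successors of each other, which is impossible for a cycle of length
        at least 3.\<close>
      then have eq: "i = Suc j mod ?n" "j = Suc i mod ?n"
        using ij m d by (auto simp: doubleton_eq_iff nth_eq_iff_index_eq)
      have step: "k' = Suc k \<or> k' = 0 \<and> Suc k = ?n" if "k' = Suc k mod ?n" "k < ?n" for k k'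
        using that by (simp add: mod_Suc split: if_splits)
      have lt: "i < ?n" "j < ?n"
        using ij(1,2) by simp_all
      show False
        using step[OF eq(1) lt(2)] step[OF eq(2) lt(1)] n by linarith
    qed
  qed
  then have "card (?e ` {..<?n}) = ?n"
    by (simp add: card_image)
  with sub show ?thesis
    using assms(2) card_mono[OF _ sub] by (simp add: induced_edges_def)
qed

lemma is_tree_if_card:
  assumes "connected_graph V E" "card V = card E + 1"
  shows "is_tree V E"
proof -
  have sg: "simple_graph V E" and fin: "finite E"
    using assms(1) simple_graph_finite_edges by (auto simp: connected_graph_def)
  have False if c: "is_cycle E xs" for xs
  proof -
    have "set xs \<subseteq> V"
    proof
      fix x assume "x \<in> set xs"
      then obtain i where "i < length xs" "x = xs ! i"
        by (metis in_set_conv_nth)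
      then show "x \<in> V"
        using is_cycle_edge[OF c] simple_graph_edgeD(1)[OF sg] by blast
    qed
    moreover have "set xs \<noteq> {}"
      using c by (auto simp: is_cycle_def)
    \<comment> \<open>A cycle induces at least as many edges as it has vertices, one more than the
      bound allows.\<close>
    ultimately have "card (induced_edges E (set xs)) < card (set xs)"
      using card_induced_edges_less[OF assms] by blast
    with card_induced_edges_cycle[OF c fin] show False
      using card_length[of xs] by linarith
  qed
  with assms(1) show ?thesis
    by (auto simp: is_tree_def)
qed

section \<open>Properties of the members of the family\<close>

lemma family_T_simple_graph:
  "family_T V E c \<Longrightarrow> simple_graph V E"
  by (induction rule: family_T.induct) (auto simp: simple_graph_def card_insert_if)

text \<open>The first operation adds 2 vertices, 2 edges and 1 amber vertex; the second adds 4, 4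
  and 2. Both relations hold for the initial path and are kept.\<close>

lemma family_T_card:
  "family_T V E c \<Longrightarrow> card V = card E + 1 \<and> card V = 2 * card {v \<in> V. c v = Amber}"
proof (induction rule: family_T.induct)
  case (P4 p q r s c)
  then have "{v \<in> {p, q, r, s}. c v = Amber} = {q, r}"
    by auto
  then show ?case
    using P4 by (simp add: doubleton_eq_iff)
next
  case (O1 V E c x y w)
  have sg: "simple_graph V E"
    using O1 family_T_simple_graph by blast
  then have fin: "finite V" "finite E"
    using simple_graph_finite_edges by (auto simp: simple_graph_def)
  have "{x, y} \<notin> E" "{x, w} \<notin> E" "w \<noteq> y"
    using O1 simple_graph_edgeD[OF sg] by auto
  then have E: "card (E \<union> {{x, y}, {x, w}}) = card E + 2"
    using O1 fin by (auto simp: doubleton_eq_iff)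
  have "{v \<in> V \<union> {x, y}. (c(x := Amber, y := Blue)) v = Amber} = insert x {v \<in> V. c v = Amber}"
    using O1 by auto
  then have "card {v \<in> V \<union> {x, y}. (c(x := Amber, y := Blue)) v = Amber} =
      card {v \<in> V. c v = Amber} + 1"
    using O1 fin by simp
  moreover have "card (V \<union> {x, y}) = card V + 2"
    using O1 fin by (simp add: card_insert_if)
  ultimately show ?case
    using E O1.IH by linarith
next
  case (O2 V E c p q r s w)
  have sg: "simple_graph V E"
    using O2 family_T_simple_graph by blast
  then have fin: "finite V" "finite E"
    using simple_graph_finite_edges by (auto simp: simple_graph_def)
  have "{p, q} \<notin> E" "{q, r} \<notin> E" "{r, s} \<notin> E" "{p, w} \<notin> E"
    using O2 simple_graph_edgeD[OF sg] by auto
  moreover have "w \<noteq> p" "w \<noteq> q" "w \<noteq> r" "w \<noteq> s"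
    using O2 by auto
  ultimately have E: "card (E \<union> {{p, q}, {q, r}, {r, s}, {p, w}}) = card E + 4"
    using O2 fin by (auto simp: doubleton_eq_iff card_insert_if)
  let ?c = "c(p := Blue, q := Amber, r := Amber, s := Blue)"
  have "{v \<in> V \<union> {p, q, r, s}. ?c v = Amber} = insert q (insert r {v \<in> V. c v = Amber})"
    using O2 by auto
  then have "card {v \<in> V \<union> {p, q, r, s}. ?c v = Amber} = card {v \<in> V. c v = Amber} + 2"
    using O2 fin by simp
  moreover have "card (V \<union> {p, q, r, s}) = card V + 4"
    using O2 fin by (simp add: card_insert_if)
  ultimately show ?case
    using E O2.IH by linarith
qed

text \<open>The first part makes \<open>v\<close> a private blue neighbour of \<open>u\<close>; the
  second supplies the other neighbour needed for degree at least 2. Both survive the operations,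
  since the connecting edge joins two vertices of the same color.\<close>

lemma family_T_amber:
  assumes "family_T V E c" "u \<in> V" "c u = Amber"
  shows "(\<exists>v\<in>V. c v = Blue \<and> (\<forall>z\<in>V. c z = Amber \<longrightarrow> ({v, z} \<in> E \<longleftrightarrow> z = u))) \<and>
         (\<exists>u'\<in>V. c u' = Amber \<and> {u, u'} \<in> E)"
  using assms
proof (induction arbitrary: u rule: family_T.induct)
  case (P4 p q r s c)
  then have "u = q \<or> u = r" by auto
  then show ?case
  proof
    assume u: "u = q"
    show ?thesis
      using P4 u by (intro conjI bexI[of _ p] bexI[of _ r]) (auto simp: doubleton_eq_iff)
  next
    assume u: "u = r"
    show ?thesis
      using P4 u by (intro conjI bexI[of _ s] bexI[of _ q]) (auto simp: doubleton_eq_iff)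
  qed
next
  case (O1 V E c x y w)
  have sg: "simple_graph V E"
    using O1 family_T_simple_graph by blast
  note e = simple_graph_edgeD[OF sg]
  have nE: "{a, b} \<notin> E" "{b, a} \<notin> E" if "a \<in> {x, y}" for a b
    using that O1 e by blast+
  have w: "w \<noteq> x" "w \<noteq> y" using O1 by auto
  show ?case
  proof (cases "u = x")
    case True
    \<comment> \<open>The leaf \<open>y\<close> is the private neighbour, and the attachment vertex
      \<open>w\<close> is the amber one.\<close>
    show ?thesis
      using O1 True nE w
      by (intro conjI bexI[of _ y] bexI[of _ w]) (auto simp: doubleton_eq_iff)
  next
    case False
    with O1 have u: "u \<in> V" "c u = Amber" by (auto split: if_splits)
    from O1.IH[OF u] obtain v u' where v: "v \<in> V" "c v = Blue"
        "\<And>z. z \<in> V \<Longrightarrow> c z = Amber \<Longrightarrow> {v, z} \<in> E \<longleftrightarrow> z = u"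
      and u': "u' \<in> V" "c u' = Amber" "{u, u'} \<in> E"
      by blast
    \<comment> \<open>Since \<open>w\<close> is amber and \<open>v\<close> is blue, the new edge at
      \<open>w\<close> gives \<open>v\<close> no second amber neighbour.\<close>
    have "v \<noteq> x" "v \<noteq> y" "v \<noteq> w" "u' \<noteq> x" "u' \<noteq> y"
      using v u' O1 by auto
    then show ?thesis
      using O1 u v u' nE w
      by (intro conjI bexI[of _ v] bexI[of _ u']) (auto simp: doubleton_eq_iff)
  qed
next
  case (O2 V E c p q r s w)
  have sg: "simple_graph V E"
    using O2 family_T_simple_graph by blast
  note e = simple_graph_edgeD[OF sg]
  have nE: "{a, b} \<notin> E" "{b, a} \<notin> E" if "a \<in> {p, q, r, s}" for a b
    using that O2 e by blast+
  have w: "w \<noteq> p" "w \<noteq> q" "w \<noteq> r" "w \<noteq> s" using O2 by auto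
  consider "u = q" | "u = r" | "u \<in> V" "c u = Amber" "u \<noteq> q" "u \<noteq> r"
    using O2 by (auto split: if_splits)
  then show ?case
  proof cases
    case 1
    \<comment> \<open>The leaf \<open>p\<close> gains the neighbour \<open>w\<close>, but
      \<open>w\<close> is blue, so \<open>p\<close> stays private to \<open>q\<close>.\<close>
    show ?thesis
      using O2 1 nE w
      by (intro conjI bexI[of _ p] bexI[of _ r]) (auto simp: doubleton_eq_iff)
  next
    case 2
    show ?thesis
      using O2 2 nE w
      by (intro conjI bexI[of _ s] bexI[of _ q]) (auto simp: doubleton_eq_iff)
  next
    case 3
    from O2.IH[OF 3(1,2)] obtain v u' where v: "v \<in> V" "c v = Blue"
        "\<And>z. z \<in> V \<Longrightarrow> c z = Amber \<Longrightarrow> {v, z} \<in> E \<longleftrightarrow> z = u"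
      and u': "u' \<in> V" "c u' = Amber" "{u, u'} \<in> E"
      by blast
    \<comment> \<open>Here \<open>v\<close> may be \<open>w\<close> itself; its new neighbour
      \<open>p\<close> is blue and does no harm.\<close>
    have "v \<notin> {p, q, r, s}" "u' \<notin> {p, q, r, s}"
      using v u' O2 by auto
    then show ?thesis
      using O2 3 v u' nE w
      by (intro conjI bexI[of _ v] bexI[of _ u']) (auto simp: doubleton_eq_iff)
  qed
qed

lemma family_T_esd_set:
  assumes "family_T V E c"
  shows "esd_set V E {v \<in> V. c v = Blue}"
  unfolding esd_set_def
proof (intro conjI ballI)
  show "{v \<in> V. c v = Blue} \<subseteq> V" by blast
  fix u assume "u \<in> V - {v \<in> V. c v = Blue}"
  then have u: "u \<in> V" "c u = Amber"
    by (auto intro: color.exhaust)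
  have amber: "z \<in> V - {v \<in> V. c v = Blue} \<longleftrightarrow> z \<in> V \<and> c z = Amber" for z
    by (cases "c z") auto
  from family_T_amber[OF assms u] obtain v u' where
    v: "v \<in> V" "c v = Blue" "\<forall>z\<in>V. c z = Amber \<longrightarrow> ({v, z} \<in> E \<longleftrightarrow> z = u)"
    and u': "u' \<in> V" "c u' = Amber" "{u, u'} \<in> E"
    by blast
  have "nbhd E v \<inter> (V - {v \<in> V. c v = Blue}) = {u}"
    using v u amber unfolding nbhd_def adj_def by blast
  with v show "\<exists>v\<in>{v \<in> V. c v = Blue}. nbhd E v \<inter> (V - {v \<in> V. c v = Blue}) = {u}"
    by blast
  have sg: "simple_graph V E"
    using assms family_T_simple_graph by blast
  \<comment> \<open>The private neighbour is blue and \<open>u'\<close> is amber, so they are two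
    different neighbours of \<open>u\<close>.\<close>
  have "{v, u'} \<subseteq> nbhd E u" "nbhd E u \<subseteq> V"
    using u v u' simple_graph_edgeD[OF sg] by (auto simp: nbhd_def adj_def insert_commute)
  moreover have "finite V"
    using sg by (simp add: simple_graph_def)
  moreover have "v \<noteq> u'"
    using v u' by auto
  then have "card {v, u'} = 2"
    by simp
  ultimately show "degree E u \<ge> 2"
    unfolding degree_def by (metis card_mono finite_subset)
qed

section \<open>The lower bound on the size of an ESD-set\<close>

lemma esd_set_private_neighbours:
  assumes "esd_set V E S"
  obtains f where "inj_on f (V - S)" "f ` (V - S) \<subseteq> S"
    "\<And>u. u \<in> V - S \<Longrightarrow> nbhd E (f u) \<inter> (V - S) = {u}"
proof -
  obtain f where f: "\<And>u. u \<in> V - S \<Longrightarrow> f u \<in> S \<and> nbhd E (f u) \<inter> (V - S) = {u}"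
    using assms unfolding esd_set_def by metis
  \<comment> \<open>The vertex \<open>u\<close> is recovered from \<open>f u\<close> as its only
    neighbour outside \<open>S\<close>.\<close>
  have "inj_on f (V - S)"
    using f by (metis inj_onI singleton_inject)
  then show thesis
    using that f by blast
qed

lemma esd_set_card_ge:
  assumes "esd_set V E S" "finite V"
  shows "card V \<le> 2 * card S"
proof -
  have S: "S \<subseteq> V" "finite S"
    using assms finite_subset by (auto simp: esd_set_def)
  obtain f where "inj_on f (V - S)" "f ` (V - S) \<subseteq> S"
    using esd_set_private_neighbours[OF assms(1)] by metis
  then have "card (V - S) \<le> card S"
    using S card_inj_on_le by blast
  then show ?thesis
    using S assms by (simp add: card_Diff_subset)
qed

section \<open>The equality case: building the graph by the two operations\<close>

lemma induced_edges_eq_insert: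
  assumes conn: "connected_graph V E" and tree: "card V = card E + 1"
    and W': "W' \<subseteq> V" "W' \<noteq> {}" and D: "D \<subseteq> induced_edges E W'"
    and card: "card W' \<le> card D + 1"
  shows "induced_edges E W' = D"
proof -
  have "finite (induced_edges E W')"
    using conn simple_graph_finite_edges[of V E]
    by (simp add: connected_graph_def induced_edges_def)
  \<comment> \<open>At most |W'| - 1 edges can be induced, and \<open>D\<close> already has that
    many.\<close>
  moreover have "card (induced_edges E W') \<le> card D"
    using card_induced_edges_less[OF conn tree W'] card by linarith
  ultimately show ?thesis
    using D card_seteq by metis
qed

lemma family_T_if_balanced_esd_set:
  assumes conn: "connected_graph V E" and tree: "card V = card E + 1"
    and esd: "esd_set V E S" and half: "card V = 2 * card S"
  shows "family_T V E (\<lambda>v. if v \<in> S then Blue else Amber)"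
proof -
  define c where "c = (\<lambda>v. if v \<in> S then Blue else Amber)"
  define U where "U = V - S"
  have sg: "simple_graph V E" and finV: "finite V" and finE: "finite E"
    using conn simple_graph_finite_edges by (auto simp: connected_graph_def simple_graph_def)
  note e = simple_graph_edgeD[OF sg]
  have SV: "S \<subseteq> V" and finS: "finite S"
    using esd finV finite_subset by (auto simp: esd_set_def)
  obtain f where inj: "inj_on f U" and img: "f ` U \<subseteq> S"
    and priv: "\<And>u. u \<in> U \<Longrightarrow> nbhd E (f u) \<inter> U = {u}"
    using esd_set_private_neighbours[OF esd] unfolding U_def by metis
  have "card U = card S"
    using half SV finS by (simp add: U_def card_Diff_subset)
  then have onto: "f ` U = S"
    using inj img finS by (metis card_image card_seteq order_refl)
  \<comment> \<open>As \<open>f\<close> maps \<open>U\<close> onto \<open>S\<close>, this makes the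
    pairs \<open>{u, f u}\<close> the only edges between \<open>U\<close> and
    \<open>S\<close>.\<close>
  have match: "{f u, u'} \<in> E \<longleftrightarrow> u' = u" if "u \<in> U" "u' \<in> U" for u u'
    using priv[OF that(1)] that by (auto simp: nbhd_def adj_def)
  have fS: "f u \<in> S" if "u \<in> U" for u
    using img that by blast
  have US: "u \<notin> S" "u \<in> V" if "u \<in> U" for u
    using that by (auto simp: U_def)
  have f_neq: "f u \<noteq> u'" if "u \<in> U" "u' \<in> U" for u u'
    using that fS US by metis
  have ufu: "{u, f u} \<in> E" if "u \<in> U" for u
    using match[OF that that] by (simp add: insert_commute)
  \<comment> \<open>Degree at least 2 gives a neighbour other than \<open>f u\<close>; by the
    matching it cannot lie in \<open>S\<close>.\<close>
  have amber_nb: "\<exists>u'\<in>U. {u, u'} \<in> E" if "u \<in> U" for u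
  proof -
    have "card (nbhd E u) \<ge> 2"
      using esd that by (auto simp: esd_set_def U_def degree_def)
    then have "\<not> nbhd E u \<subseteq> {f u}"
      using card_mono[of "{f u}" "nbhd E u"] by auto
    then obtain z where z: "{u, z} \<in> E" "z \<noteq> f u"
      by (auto simp: nbhd_def adj_def)
    have "z \<in> U"
    proof (rule ccontr)
      assume "z \<notin> U"
      then have "z \<in> S"
        using e(2)[OF z(1)] by (simp add: U_def)
      then obtain u' where "u' \<in> U" "z = f u'"
        using onto by blast
      then show False
        using match that z by (metis insert_commute)
    qed
    with z show ?thesis by blast
  qed
  \<comment> \<open>Closure under the matching ensures that a vertex outside \<open>W\<close> has
    its partner outside too.\<close>
  define good where "good W \<longleftrightarrow> W \<subseteq> V \<and> family_T W (induced_edges E W) c \<and>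
    (\<forall>u\<in>U. u \<in> W \<longleftrightarrow> f u \<in> W)" for W
  note ind_eq = induced_edges_eq_insert[OF conn tree]
  have "V \<noteq> {}" using conn by (simp add: connected_graph_def)
  \<comment> \<open>If \<open>U\<close> were empty, so would be its image \<open>S\<close>, and
    hence \<open>V\<close>.\<close>
  then have "U \<noteq> {}"
    using SV onto by (auto simp: U_def)
  then obtain q r where q: "q \<in> U" and r: "r \<in> U" and qr: "{q, r} \<in> E"
    using amber_nb by blast
  have "q \<noteq> r" using e(3)[OF qr] .
  \<comment> \<open>Two adjacent amber vertices and their partners form the initial path, so a good
    set exists.\<close>
  have d: "distinct [f q, q, r, f r]"
    using q r \<open>q \<noteq> r\<close> f_neq inj by (auto simp: inj_on_def dest: sym)
  let ?P = "{{f q, q}, {q, r}, {r, f r}}"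
  have "induced_edges E {f q, q, r, f r} = ?P"
  proof (rule ind_eq)
    show "?P \<subseteq> induced_edges E {f q, q, r, f r}"
      using qr ufu[OF q] ufu[OF r] by (auto simp: induced_edges_def insert_commute)
    show "card {f q, q, r, f r} \<le> card ?P + 1"
      using d by (simp add: doubleton_eq_iff)
    show "{f q, q, r, f r} \<subseteq> V"
      using q r US fS SV by auto
  qed auto
  moreover have "family_T {f q, q, r, f r} ?P c"
    using d q r US fS by (intro family_T.P4) (auto simp: c_def)
  moreover have "\<forall>u\<in>U. u \<in> {f q, q, r, f r} \<longleftrightarrow> f u \<in> {f q, q, r, f r}"
    using q r US fS inj by (auto simp: inj_on_def)
  ultimately have "good {f q, q, r, f r}"
    unfolding good_def using q r US fS SV by auto
  moreover have "finite {W. good W}"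
    by (rule finite_subset[of _ "Pow V"]) (use finV in \<open>auto simp: good_def\<close>)
  ultimately obtain W where W: "good W" and max: "\<And>W'. good W' \<Longrightarrow> W \<subseteq> W' \<Longrightarrow> W = W'"
    using finite_has_maximal[of "{W. good W}"] by blast
  have WV: "W \<subseteq> V" and fam: "family_T W (induced_edges E W) c"
    and closed: "\<And>u. u \<in> U \<Longrightarrow> u \<in> W \<longleftrightarrow> f u \<in> W"
    using W by (auto simp: good_def)
  have cardW: "card W = card (induced_edges E W) + 1"
    using family_T_card[OF fam] by blast
  have finW: "finite W" and finI: "finite (induced_edges E W)"
    using WV finV finite_subset finE by (auto simp: induced_edges_def)
  have "W \<noteq> {}" using cardW by auto
  have nI: "{a, b} \<notin> induced_edges E W" if "a \<notin> W \<or> b \<notin> W" for a b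
    using that by (auto simp: induced_edges_def)
  have "W = V"
  proof (rule ccontr)
    assume "W \<noteq> V"
    then obtain w x where w: "w \<in> W" and x: "x \<in> V" "x \<notin> W" and wx: "{w, x} \<in> E"
      using connected_graph_leaving_edge[OF conn WV \<open>W \<noteq> {}\<close>] by blast
    consider "w \<in> U" "x \<in> U" | "w \<in> S" "x \<in> S" | "w \<in> U" "x \<in> S" | "w \<in> S" "x \<in> U"
      using w x WV by (auto simp: U_def)
    then show False
    proof cases
      case 1
      \<comment> \<open>The first operation adds \<open>x\<close> together with its matching
        partner.\<close>
      define y where "y = f x"
      have y: "y \<in> S" "y \<notin> W" "{x, y} \<in> E" "y \<in> V"
        using 1 closed x fS ufu SV by (auto simp: y_def)
      have xy: "x \<noteq> y" "w \<noteq> x" "w \<noteq> y"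
        using y 1 US w x by auto
      let ?D = "induced_edges E W \<union> {{x, y}, {x, w}}"
      have "induced_edges E (W \<union> {x, y}) = ?D"
      proof (rule ind_eq)
        show "?D \<subseteq> induced_edges E (W \<union> {x, y})"
          using y wx w by (auto simp: induced_edges_def insert_commute)
        have "card ?D = card (induced_edges E W) + 2"
          using finI nI x y xy by (simp add: doubleton_eq_iff)
        moreover have "card (W \<union> {x, y}) = card W + 2"
          using finW x y xy by simp
        ultimately show "card (W \<union> {x, y}) \<le> card ?D + 1"
          using cardW by linarith
        show "W \<union> {x, y} \<subseteq> V" using WV x y by auto
      qed auto
      moreover have "family_T (W \<union> {x, y}) ?D (c(x := Amber, y := Blue))"
        by (rule family_T.O1[OF fam]) (use x y xy w 1 US in \<open>auto simp: c_def\<close>)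
      \<comment> \<open>The coloring \<open>c\<close> is fixed by \<open>S\<close> in advance, so
        the recoloring done by the operation changes nothing.\<close>
      moreover have "c(x := Amber, y := Blue) = c"
        using y 1 US by (auto simp: c_def)
      moreover have "\<forall>u\<in>U. u \<in> W \<union> {x, y} \<longleftrightarrow> f u \<in> W \<union> {x, y}"
        using closed 1 y fS US inj unfolding y_def by (auto simp: inj_on_def)
      ultimately have "good (W \<union> {x, y})"
        using WV x y by (simp add: good_def)
      from max[OF this] x show False by blast
    next
      case 2
      \<comment> \<open>The path for the second operation is \<open>x\<close>, its partner
        \<open>q\<close>, an amber neighbour \<open>r\<close> of \<open>q\<close>, and the partner
        \<open>s\<close> of \<open>r\<close>; it is attached by the edge from \<open>x\<close> to
        \<open>w\<close>.\<close>
      obtain q where q: "q \<in> U" "f q = x"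
        using 2 onto by blast
      have qW: "q \<notin> W" using closed q x by blast
      obtain r where r: "r \<in> U" "{q, r} \<in> E"
        using amber_nb q by blast
      define s where "s = f r"
      have xq: "{x, q} \<in> E" and rs: "{r, s} \<in> E"
        using ufu q r by (auto simp: s_def insert_commute)
      have "s \<in> S" "s \<in> V" using fS r SV by (auto simp: s_def)
      have d1: "x \<noteq> q" "q \<noteq> r" "x \<noteq> r" "w \<noteq> q" "w \<noteq> r" "w \<noteq> x" "s \<noteq> q" "s \<noteq> r"
        using q r 2 US w x qW e(3)[OF r(2)] \<open>s \<in> S\<close> by auto
      have "x \<noteq> s"
        using q r d1 inj by (auto simp: s_def inj_on_def)
      \<comment> \<open>If \<open>r\<close> were in \<open>W\<close>, adding the two vertices
        \<open>x\<close> and \<open>q\<close> would add three edges: |W| + 2 edges on |W| + 2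
        vertices, too many for a tree.\<close>
      have rW: "r \<notin> W"
      proof
        assume "r \<in> W"
        let ?D = "induced_edges E W \<union> {{x, q}, {q, r}, {x, w}}"
        have "?D \<subseteq> induced_edges E (W \<union> {x, q})"
          using xq r wx w \<open>r \<in> W\<close> by (auto simp: induced_edges_def insert_commute)
        moreover have "finite (induced_edges E (W \<union> {x, q}))"
          using finE by (auto simp: induced_edges_def)
        ultimately have "card ?D \<le> card (induced_edges E (W \<union> {x, q}))"
          by (intro card_mono)
        also have "\<dots> < card (W \<union> {x, q})"
          by (rule card_induced_edges_less[OF conn tree]) (use WV x q US in auto)
        also have "\<dots> = card W + 2"
          using finW x qW d1 by simp
        finally have "card ?D < card W + 2" .
        moreover have "card ?D = card (induced_edges E W) + 3"
          using finI nI x qW d1 by (simp add: doubleton_eq_iff)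
        ultimately show False
          using cardW by linarith
      qed
      then have sW: "s \<notin> W" using closed r by (auto simp: s_def)
      let ?D = "induced_edges E W \<union> {{x, q}, {q, r}, {r, s}, {x, w}}"
      have sub: "W \<union> {x, q, r, s} \<subseteq> V"
        using WV x q r US \<open>s \<in> V\<close> by auto
      have "w \<noteq> s" using w sW by blast
      have "induced_edges E (W \<union> {x, q, r, s}) = ?D"
      proof (rule ind_eq)
        show "?D \<subseteq> induced_edges E (W \<union> {x, q, r, s})"
          using xq r rs wx w by (auto simp: induced_edges_def insert_commute)
        have "card ?D = card (induced_edges E W) + 4"
          using finI nI x qW rW d1 \<open>x \<noteq> s\<close> \<open>w \<noteq> s\<close> by (simp add: doubleton_eq_iff)
        moreover have "card (W \<union> {x, q, r, s}) = card W + 4"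
          using finW x qW rW sW d1 \<open>x \<noteq> s\<close> by simp
        ultimately show "card (W \<union> {x, q, r, s}) \<le> card ?D + 1"
          using cardW by linarith
      qed (use sub in auto)
      moreover have "family_T (W \<union> {x, q, r, s}) ?D
          (c(x := Blue, q := Amber, r := Amber, s := Blue))"
        by (rule family_T.O2[OF fam])
          (use x qW rW sW d1 \<open>x \<noteq> s\<close> w 2 in \<open>auto simp: c_def\<close>)
      moreover have "c(x := Blue, q := Amber, r := Amber, s := Blue) = c"
        using 2 q r US \<open>s \<in> S\<close> by (auto simp: c_def)
      moreover have "u \<in> W \<union> {x, q, r, s} \<longleftrightarrow> f u \<in> W \<union> {x, q, r, s}" if "u \<in> U" for u
      proof -
        have "u \<notin> {x, s}" "f u \<notin> {q, r}"
          using that 2 \<open>s \<in> S\<close> US fS q r by auto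
        moreover have "f u = x \<longleftrightarrow> u = q" "f u = s \<longleftrightarrow> u = r"
          using that q r inj by (auto simp: s_def inj_on_def)
        ultimately show ?thesis
          using closed[OF that] by auto
      qed
      ultimately have "good (W \<union> {x, q, r, s})"
        using sub by (simp add: good_def)
      from max[OF this] x show False by blast
    next
      \<comment> \<open>In this case and the next, the leaving edge would join an amber and a blue
        vertex. It would then be a matching edge, and no matching edge leaves
        \<open>W\<close>.\<close>
      case 3
      then obtain u where "u \<in> U" "x = f u"
        using onto by blast
      then show False
        using match 3 wx closed w x by (metis insert_commute)
    next
      case 4
      then obtain u where "u \<in> U" "w = f u"
        using onto by blast
      then show False
        using match 4 wx closed w x by metis
    qed
  qed
  moreover have "induced_edges E V = E"
    using sg by (auto simp: induced_edges_def simple_graph_def)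
  ultimately show ?thesis
    using fam by (simp add: c_def)
qed

theorem theorem5p2:
  fixes V :: "'a set" and E :: "'a set set"
  assumes "connected_graph V E"
  shows "int (card E) \<ge> 2 * (int (card V) - int (gamma_esp V E)) - 1 \<and>
         (int (card E) = 2 * (int (card V) - int (gamma_esp V E)) - 1 \<longleftrightarrow>
            is_tree V E \<and> (\<exists>c :: 'a \<Rightarrow> color. family_T V E c))"
proof -
  have finV: "finite V"
    using assms by (auto simp: connected_graph_def simple_graph_def)
  have "gamma_esp V E \<in> card ` {S. esd_set V E S}"
    unfolding gamma_esp_def using gamma_esp_well_defined[OF finV] by (rule Min_in)
  then obtain S where S: "esd_set V E S" "card S = gamma_esp V E"
    by auto
  have n: "card V \<le> card E + 1" "card V \<le> 2 * gamma_esp V E"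
    using connected_graph_card_vertices_le[OF assms] esd_set_card_ge[OF S(1) finV] S(2) by auto
  show ?thesis
    unfolding right_diff_distrib
  proof (intro conjI iffI)
    show "int (card E) \<ge> 2 * int (card V) - 2 * int (gamma_esp V E) - 1"
      using n by linarith
  next
    assume "int (card E) = 2 * int (card V) - 2 * int (gamma_esp V E) - 1"
    \<comment> \<open>The inequality is the chain m >= n - 1 >= 2 (n - \<open>gamma_esp\<close>) -
      1, so equality makes both links tight.\<close>
    with n S have eq: "card V = card E + 1" "card V = 2 * card S"
      by linarith+
    show "is_tree V E"
      using is_tree_if_card[OF assms eq(1)] .
    show "\<exists>c :: 'a \<Rightarrow> color. family_T V E c"
      using family_T_if_balanced_esd_set[OF assms eq(1) S(1) eq(2)] by blast
  next
    assume "is_tree V E \<and> (\<exists>c :: 'a \<Rightarrow> color. family_T V E c)"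
    then obtain c where c: "family_T V E c" by blast
    \<comment> \<open>The blue vertices form an ESD-set with half of the vertices. With n <= 2
      \<open>gamma_esp\<close> this gives n = 2 \<open>gamma_esp\<close>, and m = n - 1 yields the
      equality.\<close>
    have "gamma_esp V E \<le> card {v \<in> V. c v = Blue}"
      unfolding gamma_esp_def
      by (intro Min_le gamma_esp_well_defined(1)[OF finV] imageI CollectI family_T_esd_set[OF c])
    moreover have "{v \<in> V. c v = Blue} = V - {v \<in> V. c v = Amber}"
    proof (intro set_eqI)
      fix v show "v \<in> {v \<in> V. c v = Blue} \<longleftrightarrow> v \<in> V - {v \<in> V. c v = Amber}"
        by (cases "c v") simp_all
    qed
    then have "card {v \<in> V. c v = Blue} = card V - card {v \<in> V. c v = Amber}"
      using finV by (simp add: card_Diff_subset)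
    ultimately show "int (card E) = 2 * int (card V) - 2 * int (gamma_esp V E) - 1"
      using family_T_card[OF c] n by linarith
  qed
qed

end
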